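(* For all $i\ge 2$, $j\ge 0$, if $f^*(i,j)=B$, then $f^*(i-1,j)=B$.
   Context: Let $0<\lambda<\mu$ and costs $c>0$, $d\ge 0$. Interpretation: in a two-queue polling system with Poisson($\lambda$) arrivals, exponential($\mu$) services, exhaustive service and no switch-over times, $(i,j)$ means $i$ customers in the busy queue and $j$ in the idle queue; waiting costs $c$ per unit time in the busy queue and $d$ in the idle queue; $f^*(i,j)=B$ (resp. $I$) means that a customer arriving in state $(i,j)$ joins the busy (resp. idle) queue under the individually optimal policy. Recursion: put $\tau_0(i,j)=i/\mu$ for $i\ge 1,j\ge 0$, and $\tau_n(0,j)=0$ for all $n,j\ge0$. For all $n\ge 0$, $i\ge 1$, $j\ge 0$ define $$\delta_n(i,j)=\begin{cases}(i+1,j) & \text{if } ci/\mu<d\,\tau_n(i,j+1)+cj/\mu,\\ (i,j+1) & \text{if } ci/\mu\ge d\,\tau_n(i,j+1)+cj/\mu,\end{cases}$$ $$\tau_{n+1}(i,j)=\frac{1}{\lambda+\mu}+\frac{\mu}{\lambda+\mu}\tau_n(i-1,j)+\frac{\lambda}{\lambda+\mu}\tau_n(\delta_n(i,j)).$$ The limits $\tau(i,j)=\lim_{n\to\infty}\tau_n(i,j)$ and $\delta(i,j)=\lim_{n\to\infty}\delta_n(i,j)$ (eventually constant) exist, and $f^*$ is defined for $i\ge1$, $j\ge0$ by $f^*(i,j)=B$ if $\delta(i,j)=(i+1,j)$ and $f^*(i,j)=I$ if $\delta(i,j)=(i,j+1)$; equivalently $f^*(i,j)=B\Leftrightarrow ci/\mu<d\,\tau(i,j+1)+cj/\mu$.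 *)

theory Defs
  imports "HOL-Analysis.Analysis"
begin

text \<open>
  A state \<open>(i, j)\<close> consists of \<open>i\<close> customers in the busy and \<open>j\<close> customers in the idle queue of
  a two-queue polling system with arrival rate \<open>lam\<close>, service rate \<open>mu\<close>, exhaustive service, no
  switch-over times, and waiting costs \<open>c\<close> (busy queue) and \<open>d\<close> (idle queue) per unit time.
\<close>

datatype queue = Busy | Idle

text \<open>
  One decision step: the state after an arrival in \<open>(i, j)\<close>, when \<open>t\<close> is the current iterate of
  the expected time until the server switches.  Ties are resolved in favour of the idle queue.
\<close>

definition next_state ::
    "real \<Rightarrow> real \<Rightarrow> real \<Rightarrow> (nat \<Rightarrow> nat \<Rightarrow> real) \<Rightarrow> nat \<Rightarrow> nat \<Rightarrow> nat \<times> nat" where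
  "next_state mu c d t i j =
     (if c * real i / mu < d * t i (j + 1) + c * real j / mu then (i + 1, j) else (i, j + 1))"

primrec tau :: "real \<Rightarrow> real \<Rightarrow> real \<Rightarrow> real \<Rightarrow> nat \<Rightarrow> nat \<Rightarrow> nat \<Rightarrow> real" where
  "tau lam mu c d 0 = (\<lambda>i j. if i = 0 then 0 else real i / mu)"
| "tau lam mu c d (Suc n) = (\<lambda>i j. if i = 0 then 0 else
     1 / (lam + mu)
     + mu / (lam + mu) * tau lam mu c d n (i - 1) j
     + lam / (lam + mu) *
         (case next_state mu c d (tau lam mu c d n) i j of (i', j') \<Rightarrow> tau lam mu c d n i' j'))"

definition delta :: "real \<Rightarrow> real \<Rightarrow> real \<Rightarrow> real \<Rightarrow> nat \<Rightarrow> nat \<Rightarrow> nat \<Rightarrow> nat \<times> nat" where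
  "delta lam mu c d n i j = next_state mu c d (tau lam mu c d n) i j"

text \<open>
  The topology on \<^typ>\<open>nat \<times> nat\<close> is discrete, so this limit is the eventual value of the sequence.
\<close>

definition delta_lim :: "real \<Rightarrow> real \<Rightarrow> real \<Rightarrow> real \<Rightarrow> nat \<Rightarrow> nat \<Rightarrow> nat \<times> nat" where
  "delta_lim lam mu c d i j = lim (\<lambda>n. delta lam mu c d n i j)"

text \<open>
  The individually optimal policy, meaningful for \<open>i \<ge> 1\<close> only.  Every \<^const>\<open>delta\<close> value is either
  \<open>(i + 1, j)\<close> or \<open>(i, j + 1)\<close>, hence so is the limit whenever it exists; the last branch is
  therefore never taken for a convergent sequence.
\<close>

definition f_star :: "real \<Rightarrow> real \<Rightarrow> real \<Rightarrow> real \<Rightarrow> nat \<Rightarrow> nat \<Rightarrow> queue" where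
  "f_star lam mu c d i j =
     (if delta_lim lam mu c d i j = (i + 1, j) then Busy
      else if delta_lim lam mu c d i j = (i, j + 1) then Idle
      else undefined)"

end

theory Submission
  imports Defs
begin

text \<open>
  The iterates increase to a limit \<open>t\<close> with \<open>t i j \<le> i / (mu - lam)\<close>, and Busy is chosen in the
  limit iff it is chosen for \<open>t\<close>.

  If \<open>d / (mu - lam) \<le> c / mu\<close>, the increments of \<open>t\<close> in \<open>i\<close> are at most \<open>1 / (mu - lam)\<close>, so
  passing from \<open>i - 1\<close> to \<open>i\<close> raises the cost of joining the idle queue by no more than the cost
  of joining the busy queue.

  Otherwise Busy is chosen everywhere. Put \<open>\<rho> = c (mu - lam) / (mu d) < 1\<close>. The function
  \<open>Z i j = i + j - (mu - lam) t i j\<close> is the expected final length of the idle queue, hence harmonic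
  for the controlled chain, and choosing Idle in \<open>(i, j)\<close> forces
  \<open>Z i (j + 1) \<ge> (1 + \<rho>) j + 1 + (1 - \<rho>) i\<close>: given that the idle queue grows beyond \<open>j\<close>, its
  expected final length exceeds \<open>j\<close> by a fixed factor, so that length would have a polynomial
  tail. It is dominated by the arrivals in a busy period, whose tail is exponential. The
  contradiction is made explicit by testing with \<open>j ^ m\<close> for \<open>m \<rho> \<ge> 1\<close>.
\<close>

section \<open>Elementary estimates for powers\<close>

text \<open>With \<open>s = r * r\<close>, one factor \<open>r ^ n\<close> absorbs the new factor
  \<open>n\<close> by Bernoulli and the other absorbs \<open>n ^ m\<close> by induction; hence
  \<open>s\<close> is arbitrary in the induction.\<close>

lemma power_le_exponential:
  fixes s :: real
  assumes "1 < s"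
  shows "\<exists>K\<ge>0. \<forall>n. real n ^ m \<le> K * s ^ n"
  using assms
proof (induction m arbitrary: s)
  case 0
  then show ?case by (intro exI[of _ 1]) auto
next
  case (Suc m)
  define r where "r = sqrt s"
  have r: "1 < r" and s: "s = r * r"
    using Suc.prems by (simp_all add: r_def)
  obtain K where K: "0 \<le> K" "\<And>n. real n ^ m \<le> K * r ^ n"
    using Suc.IH[OF r] by blast
  have "real n ^ Suc m \<le> K / (r - 1) * s ^ n" for n
  proof -
    have "real n * (r - 1) \<le> r ^ n"
      using Bernoulli_inequality[of "r - 1" n] r by simp
    then have "real n \<le> r ^ n / (r - 1)"
      using r by (simp add: field_simps)
    then have "real n * real n ^ m \<le> r ^ n / (r - 1) * (K * r ^ n)"
      using K r by (intro mult_mono) auto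
    then show ?thesis by (simp add: s power_mult_distrib ac_simps)
  qed
  moreover have "0 \<le> K / (r - 1)"
    using K r by simp
  ultimately show ?case by blast
qed

text \<open>Discrete form of x f'(x) = m f(x) for f(x) = x^m; the extra factor \<open>x\<close>
  avoids the exponent m - 1.\<close>

lemma power_increment_ge:
  fixes x :: real
  assumes "0 \<le> x"
  shows "real m * x ^ m \<le> x * ((x + 1) ^ m - x ^ m)"
proof (induction m)
  case (Suc m)
  have "x ^ m \<le> (x + 1) ^ m"
    using assms by (intro power_mono) auto
  then have "x * x ^ m \<le> x * (x + 1) ^ m"
    using assms by (rule mult_left_mono)
  moreover have "x * (real m * x ^ m) \<le> x * (x * ((x + 1) ^ m - x ^ m))"
    using Suc assms by (rule mult_left_mono)
  ultimately show ?case by (simp add: algebra_simps)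
qed simp

section \<open>Monotonicity and boundedness of the iterates\<close>

locale polling =
  fixes lam mu c d :: real
  assumes lam_pos: "0 < lam" and lam_less_mu: "lam < mu" and c_pos: "0 < c" and d_nonneg: "0 \<le> d"
begin

abbreviation T :: "nat \<Rightarrow> nat \<Rightarrow> nat \<Rightarrow> real" where
  "T \<equiv> tau lam mu c d"

definition busy :: "(nat \<Rightarrow> nat \<Rightarrow> real) \<Rightarrow> nat \<Rightarrow> nat \<Rightarrow> bool" where
  "busy t i j \<longleftrightarrow> c * real i / mu < d * t i (Suc j) + c * real j / mu"

text \<open>The function \<open>t\<close> that decides is kept apart from the function
  \<open>u\<close> that is evaluated, so that other functions can be followed under the policy of
  \<open>t\<close>.\<close>

definition arrive :: "(nat \<Rightarrow> nat \<Rightarrow> real) \<Rightarrow> (nat \<Rightarrow> nat \<Rightarrow> real) \<Rightarrow> nat \<Rightarrow> nat \<Rightarrow> real" where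
  "arrive t u i j = (if busy t i j then u (Suc i) j else u i (Suc j))"

lemma mu_pos: "0 < mu"
  using lam_pos lam_less_mu by simp

lemma tau_zero [simp]: "T n 0 j = 0"
  by (cases n) simp_all

lemma tau_Suc:
  "(lam + mu) * T (Suc n) (Suc i) j = 1 + mu * T n i j + lam * arrive (T n) (T n) (Suc i) j"
proof -
  have "(lam + mu) * (1 / (lam + mu) + mu / (lam + mu) * x + lam / (lam + mu) * y)
      = 1 + mu * x + lam * y" for x y
    using lam_pos mu_pos by (simp add: distrib_left)
  then show ?thesis
    by (simp add: next_state_def arrive_def busy_def)
qed

lemma tau_0 [simp]: "T 0 i j = real i / mu"
  by simp

declare tau.simps [simp del]

lemma busy_mono:
  assumes "busy t i j" and "t i (Suc j) \<le> u i (Suc j)"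
  shows "busy u i j"
  using assms mult_left_mono[OF assms(2) d_nonneg] by (simp add: busy_def)

lemma tau_nonneg: "0 \<le> T n i j"
proof (induction n arbitrary: i j)
  case 0
  then show ?case using mu_pos by simp
next
  case (Suc n)
  show ?case
  proof (cases i)
    case (Suc i')
    have "0 \<le> arrive (T n) (T n) i j"
      using Suc.IH by (simp add: arrive_def)
    then have "0 \<le> (lam + mu) * T (Suc n) i j"
      using Suc.IH[of i' j] lam_pos mu_pos by (simp add: Suc tau_Suc)
    then show ?thesis
      using lam_pos mu_pos by (simp add: zero_le_mult_iff)
  qed simp
qed

text \<open>The state \<open>(Suc i, Suc j)\<close> separates the two arrivals: by induction its
  value bounds one from above and the other from below, whatever the decisions are.\<close>

lemma tau_shift: "T n i (Suc j) \<le> T n (Suc i) j"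
proof (induction n arbitrary: i j)
  case 0
  then show ?case using mu_pos by (simp add: field_simps)
next
  case (Suc n)
  show ?case
  proof (cases i)
    case 0
    then show ?thesis by (simp add: tau_nonneg)
  next
    case (Suc i')
    have "arrive (T n) (T n) i (Suc j) \<le> T n (Suc i) (Suc j)"
      using Suc.IH[of i "Suc j"] by (simp add: arrive_def)
    also have "\<dots> \<le> arrive (T n) (T n) (Suc i) j"
      using Suc.IH[of "Suc i" j] by (simp add: arrive_def)
    finally have "lam * arrive (T n) (T n) i (Suc j) \<le> lam * arrive (T n) (T n) (Suc i) j"
      using lam_pos by simp
    moreover have "mu * T n i' (Suc j) \<le> mu * T n i j"
      using Suc.IH[of i' j] Suc mu_pos by simp
    ultimately have "(lam + mu) * T (Suc n) i (Suc j) \<le> (lam + mu) * T (Suc n) (Suc i) j"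
      by (simp add: Suc tau_Suc)
    then show ?thesis using lam_pos mu_pos by simp
  qed
qed

text \<open>Larger values can change a decision only from Idle to Busy, and by
  \<open>tau_shift\<close> that change raises the value too.\<close>

lemma tau_mono_Suc: "T n i j \<le> T (Suc n) i j"
proof (induction n arbitrary: i j)
  case 0
  show ?case
  proof (cases i)
    case (Suc i')
    have "real i / mu \<le> arrive (T 0) (T 0) i j"
      using mu_pos by (simp add: Suc arrive_def field_simps)
    then have "lam * (real i / mu) \<le> lam * arrive (T 0) (T 0) i j"
      using lam_pos by (intro mult_left_mono) auto
    moreover have "mu * (real i / mu) = 1 + mu * T 0 i' j"
      using mu_pos by (simp add: Suc)
    ultimately have "lam * (real i / mu) + mu * (real i / mu) \<le> (lam + mu) * T (Suc 0) i j"
      unfolding Suc tau_Suc by linarith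
    then have "(lam + mu) * T 0 i j \<le> (lam + mu) * T (Suc 0) i j"
      by (simp only: tau_0 distrib_right)
    then show ?thesis using lam_pos mu_pos by (simp del: times_divide_eq_right)
  qed simp
next
  case (Suc n)
  show ?case
  proof (cases i)
    case (Suc i')
    have "arrive (T n) (T n) i j \<le> arrive (T (Suc n)) (T (Suc n)) i j"
      using Suc.IH[of "Suc i" j] Suc.IH[of i "Suc j"] tau_shift[of "Suc n" i j]
        busy_mono[of "T n" i j "T (Suc n)"]
      by (auto simp: arrive_def)
    then have "lam * arrive (T n) (T n) i j \<le> lam * arrive (T (Suc n)) (T (Suc n)) i j"
      using lam_pos by simp
    moreover have "mu * T n i' j \<le> mu * T (Suc n) i' j"
      using Suc.IH mu_pos by simp
    ultimately have "(lam + mu) * T (Suc n) i j \<le> (lam + mu) * T (Suc (Suc n)) i j"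
      by (simp add: Suc tau_Suc)
    then show ?thesis using lam_pos mu_pos by simp
  qed simp
qed

text \<open>The bound is the mean busy period started by \<open>i\<close> customers when every
  arrival joins the busy queue.\<close>

lemma tau_upper: "T n i j \<le> real i / (mu - lam)"
proof (induction n arbitrary: i j)
  case 0
  then show ?case using lam_pos lam_less_mu by (auto intro: divide_left_mono)
next
  case (Suc n)
  show ?case
  proof (cases i)
    case (Suc i')
    have "real i / (mu - lam) \<le> real (Suc i) / (mu - lam)"
      using lam_less_mu by (intro divide_right_mono) auto
    then have "arrive (T n) (T n) i j \<le> real (Suc i) / (mu - lam)"
      using Suc.IH[of "Suc i" j] Suc.IH[of i "Suc j"] by (auto simp: arrive_def)
    then have "lam * arrive (T n) (T n) i j \<le> lam * (real (Suc i) / (mu - lam))"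
      using lam_pos by (intro mult_left_mono) auto
    moreover have "mu * T n i' j \<le> mu * (real i' / (mu - lam))"
      using Suc.IH mu_pos by (intro mult_left_mono) auto
    moreover have "1 + mu * (real i' / (mu - lam)) + lam * (real (Suc i) / (mu - lam))
        = (lam + mu) * (real i / (mu - lam))"
    proof -
      have "mu * (1 / (mu - lam)) = 1 + lam * (1 / (mu - lam))"
        using lam_less_mu by (simp add: field_simps)
      then have "1 + mu * (real i' * (1 / (mu - lam))) + lam * ((real i' + 2) * (1 / (mu - lam)))
          = (lam + mu) * ((real i' + 1) * (1 / (mu - lam)))"
        by algebra
      then show ?thesis by (simp add: Suc add.commute)
    qed
    ultimately have "(lam + mu) * T (Suc n) i j \<le> (lam + mu) * (real i / (mu - lam))"
      unfolding Suc tau_Suc by linarith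
    then show ?thesis using lam_pos mu_pos by (simp del: times_divide_eq_right)
  qed simp
qed

section \<open>The limit and its fixed-point equation\<close>

definition t :: "nat \<Rightarrow> nat \<Rightarrow> real" where
  "t i j = lim (\<lambda>n. T n i j)"

lemma tau_tendsto: "(\<lambda>n. T n i j) \<longlonglongrightarrow> t i j"
proof -
  have "incseq (\<lambda>n. T n i j)"
    by (intro incseq_SucI tau_mono_Suc)
  then have "convergent (\<lambda>n. T n i j)"
    by (metis convergentI incseq_convergent tau_upper)
  then show ?thesis by (simp add: t_def convergent_LIMSEQ_iff)
qed

lemma tau_le_limit: "T n i j \<le> t i j"
  by (rule incseq_le[OF incseq_SucI[where X = "\<lambda>n. T n i j", OF tau_mono_Suc] tau_tendsto])

text \<open>Busy is a strict inequality, so it persists near the limit. Idle includes ties, and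
  passes from \<open>t\<close> to all iterates because they lie below \<open>t\<close>.\<close>

lemma eventually_busy_iff: "\<forall>\<^sub>F n in sequentially. busy (T n) i j \<longleftrightarrow> busy t i j"
proof (cases "busy t i j")
  case True
  have "(\<lambda>n. d * T n i (Suc j) + c * real j / mu) \<longlonglongrightarrow> d * t i (Suc j) + c * real j / mu"
    by (intro tendsto_intros tau_tendsto)
  then have "\<forall>\<^sub>F n in sequentially. busy (T n) i j"
    using True unfolding busy_def by (rule order_tendstoD)
  then show ?thesis
    by eventually_elim (simp add: True)
next
  case False
  then have "\<not> busy (T n) i j" for n
    using busy_mono[of "T n" i j t] tau_le_limit by auto
  then show ?thesis
    by (simp add: False)
qed

lemma f_star_Busy_iff: "f_star lam mu c d i j = Busy \<longleftrightarrow> busy t i j"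
proof -
  have "\<forall>\<^sub>F n in sequentially.
      delta lam mu c d n i j = (if busy t i j then (i + 1, j) else (i, j + 1))"
    using eventually_busy_iff[of i j]
    by eventually_elim (auto simp: delta_def next_state_def busy_def)
  then have "delta_lim lam mu c d i j = (if busy t i j then (i + 1, j) else (i, j + 1))"
    unfolding delta_lim_def by (intro limI tendsto_eventually)
  then show ?thesis by (simp add: f_star_def)
qed

lemma limit_zero [simp]: "t 0 j = 0"
  by (simp add: t_def)

lemma limit_nonneg: "0 \<le> t i j"
  using tau_nonneg tau_le_limit by (rule order_trans)

lemma limit_equation:
  "(lam + mu) * t (Suc i) j = 1 + mu * t i j + lam * arrive t t (Suc i) j"
proof -
  \<comment> \<open>Freezing the decision at that of \<open>t\<close> makes the limit immediate; the
    actual decisions eventually agree with it.\<close>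
  have "(\<lambda>n. arrive t (T n) (Suc i) j) \<longlonglongrightarrow> arrive t t (Suc i) j"
    by (simp add: arrive_def tau_tendsto)
  moreover have "\<forall>\<^sub>F n in sequentially. arrive t (T n) (Suc i) j = arrive (T n) (T n) (Suc i) j"
    using eventually_busy_iff[of "Suc i" j] by eventually_elim (simp add: arrive_def)
  ultimately have "(\<lambda>n. arrive (T n) (T n) (Suc i) j) \<longlonglongrightarrow> arrive t t (Suc i) j"
    by (rule Lim_transform_eventually)
  then have "(\<lambda>n. (lam + mu) * T (Suc n) (Suc i) j)
      \<longlonglongrightarrow> 1 + mu * t i j + lam * arrive t t (Suc i) j"
    unfolding tau_Suc by (intro tendsto_intros tau_tendsto)
  moreover have "(\<lambda>n. (lam + mu) * T (Suc n) (Suc i) j) \<longlonglongrightarrow> (lam + mu) * t (Suc i) j"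
    by (intro tendsto_intros filterlim_compose[OF tau_tendsto filterlim_Suc])
  ultimately show ?thesis
    using LIMSEQ_unique by blast
qed

section \<open>The case of slowly growing idle cost\<close>

text \<open>Stated for any \<open>u\<close>, since it serves both inside the induction on the
  iterates and for the limit.\<close>

lemma busy_pred:
  assumes slow: "d / (mu - lam) \<le> c / mu"
    and "busy u (Suc i) j" and "u (Suc i) (Suc j) \<le> u i (Suc j) + 1 / (mu - lam)"
  shows "busy u i j"
proof -
  have "d * u (Suc i) (Suc j) \<le> d * (u i (Suc j) + 1 / (mu - lam))"
    using assms(3) d_nonneg by (rule mult_left_mono)
  also have "\<dots> \<le> d * u i (Suc j) + c / mu"
    using slow by (simp add: algebra_simps)
  finally show ?thesis
    using assms(2) by (simp add: busy_def algebra_simps add_divide_distrib)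
qed

text \<open>The induction hypothesis feeds \<open>busy_pred\<close>, which excludes Busy at
  \<open>Suc i\<close> with Idle at \<open>i\<close>. In the opposite mixed case
  \<open>tau_shift\<close> suffices; equal decisions use the hypothesis directly.\<close>

lemma tau_increment:
  assumes slow: "d / (mu - lam) \<le> c / mu"
  shows "T n (Suc i) j \<le> T n i j + 1 / (mu - lam)"
proof (induction n arbitrary: i j)
  case 0
  have "1 / mu \<le> 1 / (mu - lam)"
    using lam_pos lam_less_mu by (simp add: divide_simps)
  then show ?case by (auto simp: add_divide_distrib)
next
  case (Suc n)
  show ?case
  proof (cases i)
    case 0
    then show ?thesis using tau_upper[of "Suc n" 1 j] by simp
  next
    case (Suc i')
    have "arrive (T n) (T n) (Suc i) j \<le> arrive (T n) (T n) i j + 1 / (mu - lam)"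
      using busy_pred[OF slow, of "T n" i j] Suc.IH[of i "Suc j"] Suc.IH[of "Suc i" j]
        tau_shift[of n "Suc i" j]
      by (auto simp: arrive_def)
    then have "lam * arrive (T n) (T n) (Suc i) j
        \<le> lam * (arrive (T n) (T n) i j + 1 / (mu - lam))"
      using lam_pos by simp
    moreover have "mu * T n i j \<le> mu * (T n i' j + 1 / (mu - lam))"
      using Suc.IH[of i' j] Suc mu_pos by simp
    ultimately have "(lam + mu) * T (Suc n) (Suc i) j
        \<le> (lam + mu) * T (Suc n) i j + (lam + mu) * (1 / (mu - lam))"
      unfolding Suc tau_Suc by (simp add: distrib_left distrib_right add_divide_distrib)
    then have "(lam + mu) * T (Suc n) (Suc i) j \<le> (lam + mu) * (T (Suc n) i j + 1 / (mu - lam))"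
      by (simp only: distrib_left)
    then show ?thesis using lam_pos mu_pos by (simp del: times_divide_eq_right)
  qed
qed

lemma limit_increment:
  assumes "d / (mu - lam) \<le> c / mu"
  shows "t (Suc i) j \<le> t i j + 1 / (mu - lam)"
  by (rule LIMSEQ_le[OF tau_tendsto tendsto_add[OF tau_tendsto tendsto_const]])
    (use tau_increment[OF assms] in auto)

section \<open>The case of fast growing idle cost\<close>

text \<open>
  The barrier \<open>s ^ (i + j)\<close> contracts under one step, because both kinds of arrival raise
  \<open>i + j\<close> by one.
\<close>

lemma maximum_principle:
  fixes Y :: "nat \<Rightarrow> nat \<Rightarrow> real"
  assumes s: "1 < s" "s < mu / lam"
    and boundary: "\<And>j. Y 0 j \<le> 0"
    and subharmonic: "\<And>i j. (lam + mu) * Y (Suc i) j \<le> mu * Y i j + lam * arrive u Y (Suc i) j"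
    and growth: "\<And>i j. Y i j \<le> K * s ^ (i + j)"
  shows "Y i j \<le> 0"
proof -
  \<comment> \<open>\<open>K\<close> may be negative, while at \<open>i = 0\<close> only
    \<open>Y 0 j \<le> 0\<close> is known; \<open>max K 0\<close> gives a bound valid there
    too.\<close>
  have K: "0 \<le> max K 0" by simp
  define \<gamma> where "\<gamma> = (mu / s + lam * s) / (lam + mu)"
  have \<gamma>_eq: "(lam + mu) * \<gamma> = mu / s + lam * s"
    using lam_pos mu_pos by (simp add: \<gamma>_def)
  have \<gamma>_nonneg: "0 \<le> \<gamma>"
    using lam_pos mu_pos s by (simp add: \<gamma>_def)
  \<comment> \<open>Dividing this product by \<open>s\<close> gives
    \<open>lam + mu - (mu / s + lam * s)\<close>, so its sign is exactly the contraction
    \<open>\<gamma> < 1\<close>.\<close>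
  have "0 < (s - 1) * (mu - lam * s)"
    using s lam_pos by (intro mult_pos_pos) (simp_all add: field_simps)
  then have "mu / s + lam * s < lam + mu"
    using s by (simp add: field_simps)
  then have \<gamma>_less: "\<gamma> < 1"
    using lam_pos mu_pos by (simp add: \<gamma>_def)
  have bound: "Y i j \<le> max K 0 * \<gamma> ^ n * s ^ (i + j)" for n i j
  proof (induction n arbitrary: i j)
    case 0
    have "K * s ^ (i + j) \<le> max K 0 * s ^ (i + j)"
      using s by (intro mult_right_mono) auto
    then show ?case using growth[of i j] by simp
  next
    case (Suc n)
    show ?case
    proof (cases i)
      case 0
      then show ?thesis
        using boundary[of j] K \<gamma>_nonneg s by (auto intro: order_trans)
    next
      case (Suc i')
      define B where "B = max K 0 * \<gamma> ^ n"
      have "arrive u Y i j \<le> B * s ^ (Suc i + j)"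
        using Suc.IH[of "Suc i" j] Suc.IH[of i "Suc j"] by (simp add: arrive_def B_def)
      then have "lam * arrive u Y i j \<le> lam * (B * s ^ (Suc i + j))"
        using lam_pos by simp
      moreover have "mu * Y i' j \<le> mu * (B * s ^ (i' + j))"
        using Suc.IH[of i' j] mu_pos by (simp add: B_def)
      moreover have "mu * (B * s ^ (i' + j)) + lam * (B * s ^ (Suc i + j))
          = (mu / s + lam * s) * (B * s ^ (i + j))"
        using s by (simp add: Suc field_simps)
      ultimately have "(lam + mu) * Y i j \<le> (mu / s + lam * s) * (B * s ^ (i + j))"
        using subharmonic[of i' j] unfolding Suc by linarith
      also have "\<dots> = (lam + mu) * (max K 0 * \<gamma> ^ Suc n * s ^ (i + j))"
        by (simp flip: \<gamma>_eq add: B_def)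
      finally show ?thesis using lam_pos mu_pos by simp
    qed
  qed
  have "(\<lambda>n. max K 0 * \<gamma> ^ n * s ^ (i + j)) \<longlonglongrightarrow> max K 0 * 0 * s ^ (i + j)"
    using \<gamma>_nonneg \<gamma>_less by (intro tendsto_intros LIMSEQ_power_zero) auto
  then show ?thesis
    using bound by (intro LIMSEQ_le_const[where X = "\<lambda>n. max K 0 * \<gamma> ^ n * s ^ (i + j)"]) auto
qed

lemma always_busy:
  assumes fast: "c / mu < d / (mu - lam)"
  shows "busy t (Suc i) j"
proof (rule ccontr)
  assume idle: "\<not> busy t (Suc i) j"
  define \<rho> where "\<rho> = c * (mu - lam) / (mu * d)"
  have "d \<noteq> 0"
    using fast divide_pos_pos[OF c_pos mu_pos] by auto
  then have d_pos: "0 < d"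
    using d_nonneg by simp
  have \<rho>_pos: "0 < \<rho>" and \<rho>_less: "\<rho> < 1"
    using fast d_pos c_pos mu_pos lam_less_mu by (simp_all add: \<rho>_def field_simps)
  define Z where "Z i j = real i + real j - (mu - lam) * t i j" for i j
  have Z_idle: "(1 + \<rho>) * real j + 1 + (1 - \<rho>) * real i \<le> Z i (Suc j)"
    if "\<not> busy t i j" for i j
  proof -
    have "t i (Suc j) \<le> c * (real i - real j) / (mu * d)"
      using that d_pos mu_pos by (simp add: busy_def field_simps)
    then have "(mu - lam) * t i (Suc j) \<le> (mu - lam) * (c * (real i - real j) / (mu * d))"
      using lam_less_mu by (intro mult_left_mono) auto
    also have "\<dots> = \<rho> * (real i - real j)"
      by (simp add: \<rho>_def)
    finally show ?thesis by (simp add: Z_def algebra_simps)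
  qed
  \<comment> \<open>The total \<open>i + j\<close> has drift \<open>lam - mu\<close> per unit time
    under either decision, and \<open>(mu - lam) * t i j\<close> compensates for it.\<close>
  have Z_harmonic: "(lam + mu) * Z (Suc i) j = mu * Z i j + lam * arrive t Z (Suc i) j" for i j
  proof -
    define a where "a = arrive t t (Suc i) j"
    have "arrive t Z (Suc i) j = real i + real j + 2 - (mu - lam) * a"
      by (simp add: a_def arrive_def Z_def)
    moreover have "(lam + mu) * Z (Suc i) j
        = (lam + mu) * (real i + 1 + real j) - (mu - lam) * ((lam + mu) * t (Suc i) j)"
      by (simp add: Z_def algebra_simps)
    then have "(lam + mu) * Z (Suc i) j
        = (lam + mu) * (real i + 1 + real j) - (mu - lam) * (1 + mu * t i j + lam * a)"
      by (simp only: limit_equation a_def)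
    ultimately show ?thesis
      by (simp add: Z_def) (simp add: algebra_simps)
  qed
  obtain m where "1 / \<rho> < real m"
    using reals_Archimedean2 by blast
  then have m: "1 \<le> \<rho> * real m"
    using \<rho>_pos by (simp add: field_simps)
  then have m_pos: "0 < m"
    by (cases m) auto
  define v where "v k = real (Suc k) ^ m - real k ^ m" for k
  have v_nonneg: "0 \<le> v k" for k
    by (simp add: v_def power_mono)
  \<comment> \<open>The sum telescopes to \<open>j ^ m - 0 ^ m\<close>, hence the need for
    \<open>m_pos\<close>.\<close>
  have v_sum: "(\<Sum>k<j. v k) = real j ^ m" for j
    using m_pos by (induction j) (simp_all add: v_def)
  \<comment> \<open>When the idle queue passes from \<open>k\<close> to \<open>Suc k\<close>, the
    product \<open>j ^ m * Z i j\<close> gains \<open>v k * Z i (Suc k)\<close> from the change of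
    weight. By \<open>Z_idle\<close> this is at least the summand here, so \<open>Y\<close> stays
    subharmonic after \<open>P\<close> is subtracted.\<close>
  define P where "P j = (\<Sum>k<j. v k * ((1 + \<rho>) * real k + 1))" for j
  define Y where "Y i j = real j ^ m * Z i j - P j" for i j
  have P_nonneg: "0 \<le> P j" for j
    unfolding P_def using v_nonneg \<rho>_pos by (intro sum_nonneg) simp
  \<comment> \<open>As \<open>Z 0 j = j\<close>, this is the boundary condition. The left side grows
    by \<open>v j * (real j + 1) + real j ^ m\<close>, so the step needs
    \<open>real j ^ m \<le> \<rho> * (real j * v j)\<close>, which is where
    \<open>m * \<rho> \<ge> 1\<close> enters.\<close>
  have "real j ^ m * real j \<le> P j" for j
  proof (induction j)
    case (Suc j)
    have "real j ^ m \<le> (\<rho> * real m) * real j ^ m"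
      using mult_right_mono[OF m, of "real j ^ m"] by simp
    also have "\<dots> \<le> \<rho> * (real j * v j)"
      using power_increment_ge[of "real j" m] \<rho>_pos by (simp add: v_def add.commute mult.assoc)
    finally have "real j ^ m \<le> \<rho> * (real j * v j)" .
    then show ?case using Suc by (simp add: P_def v_def algebra_simps)
  qed (simp add: P_def)
  then have Y_boundary: "Y 0 j \<le> 0" for j
    by (simp add: Y_def Z_def)
  have Y_subharmonic: "(lam + mu) * Y (Suc i) j \<le> mu * Y i j + lam * arrive t Y (Suc i) j" for i j
  proof -
    have "real j ^ m * arrive t Z (Suc i) j - P j \<le> arrive t Y (Suc i) j"
    proof (cases "busy t (Suc i) j")
      case False
      have "0 \<le> (1 - \<rho>) * real (Suc i)"
        using \<rho>_less by simp
      then have "(1 + \<rho>) * real j + 1 \<le> Z (Suc i) (Suc j)"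
        using Z_idle[OF False] by linarith
      then have "v j * ((1 + \<rho>) * real j + 1) \<le> v j * Z (Suc i) (Suc j)"
        using v_nonneg by (rule mult_left_mono)
      then show ?thesis
        using False by (simp add: arrive_def Y_def P_def v_def left_diff_distrib)
    qed (simp add: arrive_def Y_def)
    then have "lam * (real j ^ m * arrive t Z (Suc i) j - P j) \<le> lam * arrive t Y (Suc i) j"
      using lam_pos by simp
    moreover have "(lam + mu) * Y (Suc i) j
        = real j ^ m * ((lam + mu) * Z (Suc i) j) - (lam + mu) * P j"
      by (simp add: Y_def algebra_simps)
    then have "(lam + mu) * Y (Suc i) j
        = mu * Y i j + lam * (real j ^ m * arrive t Z (Suc i) j - P j)"
      unfolding Z_harmonic by (simp add: Y_def algebra_simps)
    ultimately show ?thesis by linarith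
  qed
  have "1 < mu / lam"
    using lam_pos lam_less_mu by simp
  then obtain s where s: "1 < s" "s < mu / lam"
    using dense by blast
  obtain K where K: "\<And>n. real n ^ Suc m \<le> K * s ^ n"
    using power_le_exponential[OF s(1)] by blast
  have Y_growth: "Y i j \<le> K * s ^ (i + j)" for i j
  proof -
    have "Z i j \<le> real (i + j)"
      using limit_nonneg[of i j] lam_less_mu by (simp add: Z_def)
    then have "real j ^ m * Z i j \<le> real j ^ m * real (i + j)"
      by (intro mult_left_mono) auto
    also have "\<dots> \<le> real (i + j) ^ m * real (i + j)"
      by (intro mult_right_mono power_mono) auto
    also have "\<dots> \<le> K * s ^ (i + j)"
      using K[of "i + j"] by (simp add: mult.commute)
    finally show ?thesis using P_nonneg[of j] by (simp add: Y_def)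
  qed
  \<comment> \<open>Just after an Idle decision \<open>Y\<close> is positive: bounding every summand
    by its last factor lets \<open>v\<close> telescope, and the term
    \<open>(1 - \<rho>) * real (Suc i)\<close> of \<open>Z_idle\<close> makes the comparison
    strict.\<close>
  have "P (Suc j) \<le> (\<Sum>k<Suc j. v k * ((1 + \<rho>) * real j + 1))"
    unfolding P_def using v_nonneg \<rho>_pos by (intro sum_mono mult_left_mono) auto
  also have "\<dots> = real (Suc j) ^ m * ((1 + \<rho>) * real j + 1)"
    by (simp only: v_sum flip: sum_distrib_right)
  also have "\<dots> < real (Suc j) ^ m * Z (Suc i) (Suc j)"
  proof -
    have "0 < (1 - \<rho>) * real (Suc i)"
      using \<rho>_less by simp
    then have "(1 + \<rho>) * real j + 1 < Z (Suc i) (Suc j)"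
      using Z_idle[OF idle] by linarith
    then show ?thesis
      by (intro mult_strict_left_mono) auto
  qed
  finally have "0 < Y (Suc i) (Suc j)"
    by (simp add: Y_def)
  then show False
    using maximum_principle[OF s Y_boundary Y_subharmonic Y_growth, of "Suc i" "Suc j"] by simp
qed

end

theorem theorem5p6:
  fixes lam mu c d :: real and i j :: nat
  assumes "0 < lam" and "lam < mu" and "c > 0" and "d \<ge> 0"
    and "i \<ge> 2"
    and "f_star lam mu c d i j = Busy"
  shows "f_star lam mu c d (i - 1) j = Busy"
proof -
  interpret polling lam mu c d
    using assms by unfold_locales
  obtain i' where i: "i = Suc (Suc i')"
    using assms(5) by (metis Suc_le_D numeral_2_eq_2 Suc_le_mono)
  have "busy t (Suc i') j"
  proof (cases "d / (mu - lam) \<le> c / mu")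
    case True
    have "busy t (Suc (Suc i')) j"
      using assms(6) by (simp add: f_star_Busy_iff i)
    then show ?thesis
      using busy_pred[OF True] limit_increment[OF True] by blast
  next
    case False
    then show ?thesis by (simp add: always_busy)
  qed
  then show ?thesis by (simp add: f_star_Busy_iff i)
qed

end
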